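(* Let $G$ be a group with the unique product property, let $A,B\subset G$ be finite subsets, and let $k\ge 1$ be an integer. Suppose that $A$ is not contained in a left coset of any cyclic subgroup of $G$, and that $|B|>4(2k+3)^3$. Then $$|AB|>|A|+|B|+k.$$
   Context: Groups are written multiplicatively and need not be abelian. For finite subsets $A,B$ of a group, $AB=\{ab:\ a\in A,\ b\in B\}$, and $|\cdot|$ denotes the cardinality of a finite set. A left coset of a subgroup $H\le G$ is a set of the form $gH$ with $g\in G$. A group $G$ has the unique product property (is a unique product group) if for every pair of finite non-empty sets $X,Y\subset G$ there is an element $g\in XY$ which can be represented in exactly one way in the form $g=xy$ with $x\in X$ and $y\in Y$. Such a group is torsion-free. *)

theory Defs
  imports "HOL-Algebra.Elementary_Groups"
begin

locale unique_product_group = group G for G (structure) +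
  assumes unique_product:
    "\<lbrakk>finite X; X \<noteq> {}; X \<subseteq> carrier G; finite Y; Y \<noteq> {}; Y \<subseteq> carrier G\<rbrakk>
      \<Longrightarrow> \<exists>g \<in> X <#> Y. \<exists>!p. p \<in> X \<times> Y \<and> g = fst p \<otimes> snd p"

definition cyclic_subgroup :: "'a set \<Rightarrow> ('a, 'b) monoid_scheme \<Rightarrow> bool"
  where "cyclic_subgroup H G \<longleftrightarrow> subgroup H G \<and> cyclic_group (G\<lparr>carrier := H\<rparr>)"

end

theory Submission
  imports Defs
begin

text \<open>Suppose \<open>|AB| \<le> |A| + |B| + k\<close>. Removing from \<open>A\<close> the left factor of a uniquely represented
  product does not increase \<open>|AB| - |A|\<close>, so one may assume that \<open>A\<close> is not contained in a coset of a
  cyclic subgroup but \<open>A - {y}\<close> is for some \<open>y\<close>; after a left translation \<open>1 \<in> A - {y} \<subseteq> C\<close> with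
  \<open>C\<close> cyclic and \<open>y \<notin> C\<close>. If \<open>B\<close> lies in one right coset of \<open>C\<close>, then \<open>yB\<close> is disjoint from
  \<open>(A - {y})B\<close> and \<open>AB\<close> is too large; otherwise \<open>|(A - {y})B| \<ge> |B| + 2|A - {y}| - 2\<close>, which forces
  \<open>|A| \<le> k + 4\<close> and \<open>|AB| \<le> |B| + m\<close> with \<open>m = 2k + 4\<close>.

  For \<open>x \<in> A\<close> the set \<open>B\<close> now splits into at most \<open>m\<close> progressions with ratio \<open>x\<close>. Let \<open>1 \<noteq> x \<in> A - {y}\<close>.
  Since \<open>|B| > 2m\<^sup>3\<close>, a long \<open>x\<close>-progression meets a \<open>y\<close>-progression twice, which gives
  \<open>z = x\<^sup>i = y\<^sup>j\<close> with \<open>1 \<le> i \<le> m\<close>, and some coset \<open>\<langle>z\<rangle>b\<close> has more than \<open>2m\<close> elements in \<open>B\<close>.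
  The size \<open>f(g) = |B \<inter> \<langle>z\<rangle>g|\<close> drops along \<open>g \<mapsto> xg\<close> and \<open>g \<mapsto> yg\<close> by at most \<open>2m\<close> in total, so some
  nonempty level set of \<open>f\<close> is closed under \<open>x\<close> and \<open>y\<close>. It consists of finitely many cosets of
  \<open>\<langle>z\<rangle>\<close>, so that \<open>\<langle>z\<rangle>\<close> is central of finite index in \<open>\<langle>x, y\<rangle>\<close>, and the transfer shows that \<open>x\<close> and
  \<open>y\<close> commute. As this holds for all \<open>x\<close>, the set \<open>A\<close> lies in a cyclic subgroup, a contradiction.\<close>

section \<open>Torsion-free groups\<close>

locale torsion_free_group = group +
  assumes torsion_free: "\<lbrakk>x \<in> carrier G; x [^] n = \<one>; 0 < (n::nat)\<rbrakk> \<Longrightarrow> x = \<one>"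
begin

lemma int_pow_eq_one:
  assumes "x \<in> carrier G" "x [^] (n::int) = \<one>" "n \<noteq> 0"
  shows "x = \<one>"
proof (cases n rule: int_cases)
  case (nonneg m)
  then show ?thesis using assms torsion_free[of x m] by (simp add: int_pow_int)
next
  case (neg m)
  then have "inv (x [^] Suc m) = \<one>"
    using assms int_pow_neg_int[of x "Suc m"] by simp
  then have "x [^] Suc m = \<one>"
    using assms(1) by (metis inv_inv inv_one nat_pow_closed)
  then show ?thesis using assms(1) torsion_free by blast
qed

lemma int_pow_inj:
  assumes "x \<in> carrier G" "x \<noteq> \<one>" "x [^] (m::int) = x [^] n"
  shows "m = n"
proof -
  have "x [^] (m - n) = \<one>"
    using assms by (simp add: int_pow_diff)
  then show ?thesis using assms(1,2) int_pow_eq_one by fastforce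
qed

lemma nat_pow_inj:
  assumes "x \<in> carrier G" "x \<noteq> \<one>" "x [^] (m::nat) = x [^] n"
  shows "m = n"
  using int_pow_inj[of x "int m" "int n"] assms by (simp add: int_pow_int)

end

section \<open>Right cosets of cyclic subgroups\<close>

context group
begin

definition power_coset :: "'a \<Rightarrow> 'a \<Rightarrow> 'a set"
  where "power_coset z g = range (\<lambda>n::int. z [^] n \<otimes> g)"

lemma self_in_power_coset: "g \<in> carrier G \<Longrightarrow> g \<in> power_coset z g"
  unfolding power_coset_def by (rule range_eqI[of _ _ 0]) simp

lemma power_coset_subset:
  "\<lbrakk>z \<in> carrier G; g \<in> carrier G\<rbrakk> \<Longrightarrow> power_coset z g \<subseteq> carrier G"
  by (auto simp: power_coset_def)

lemma power_coset_shift: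
  assumes "z \<in> carrier G" "g \<in> carrier G"
  shows "power_coset z (z [^] (n::int) \<otimes> g) = power_coset z g"
proof -
  have "z [^] (i::int) \<otimes> (z [^] n \<otimes> g) = z [^] (i + n) \<otimes> g" for i
    using assms by (simp add: int_pow_mult m_assoc)
  then have "power_coset z (z [^] n \<otimes> g) = (\<lambda>i::int. z [^] i \<otimes> g) ` range (\<lambda>i. i + n)"
    unfolding power_coset_def image_image by presburger
  moreover have "range (\<lambda>i. i + n) = UNIV"
    by (rule surjI[of _ "\<lambda>i. i - n"]) simp
  ultimately show ?thesis by (simp add: power_coset_def)
qed

lemma power_coset_eq:
  assumes "z \<in> carrier G" "g \<in> carrier G" "h \<in> power_coset z g"
  shows "power_coset z h = power_coset z g"
proof -
  obtain n :: int where "h = z [^] n \<otimes> g"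
    using assms(3) by (auto simp: power_coset_def)
  then show ?thesis using assms power_coset_shift by simp
qed

lemma power_coset_disjoint:
  assumes "z \<in> carrier G" "g \<in> carrier G" "h \<in> carrier G"
    and "power_coset z g \<noteq> power_coset z h"
  shows "power_coset z g \<inter> power_coset z h = {}"
proof (rule ccontr)
  assume "\<not> ?thesis"
  then obtain u where "u \<in> power_coset z g" "u \<in> power_coset z h" by blast
  then show False using assms power_coset_eq by metis
qed

lemma int_pow_commutes:
  assumes "x \<in> carrier G" "z \<in> carrier G" "x \<otimes> z = z \<otimes> x"
  shows "x \<otimes> z [^] (n::int) = z [^] n \<otimes> x"
proof (cases n rule: int_cases)
  case (nonneg m)
  then show ?thesis using assms group_commutes_pow[of z x m] by (simp add: int_pow_int)
next
  case (neg m)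
  have "z [^] Suc m \<otimes> x = x \<otimes> z [^] Suc m"
    using assms by (metis group_commutes_pow)
  then have "x \<otimes> inv (z [^] Suc m) = inv (z [^] Suc m) \<otimes> x"
    using assms by (metis inv_solve_left inv_solve_right m_assoc nat_pow_closed inv_closed m_closed)
  then show ?thesis using neg assms int_pow_neg_int[of z "Suc m"] by simp
qed

lemma power_coset_image:
  assumes "x \<in> carrier G" "z \<in> carrier G" "g \<in> carrier G" "x \<otimes> z = z \<otimes> x"
  shows "(\<otimes>) x ` power_coset z g = power_coset z (x \<otimes> g)"
proof -
  have "x \<otimes> (z [^] (n::int) \<otimes> g) = z [^] n \<otimes> (x \<otimes> g)" for n
    using assms int_pow_commutes[of x z n] by (simp flip: m_assoc)
  then show ?thesis by (simp add: power_coset_def image_image)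
qed

end

context torsion_free_group
begin

text \<open>Transfer into the infinite cyclic group generated by \<open>z\<close>: counting, over a set \<open>R\<close> of
  representatives of the finitely many cosets in \<open>T\<close>, the powers of \<open>z\<close> picked up under
  multiplication by \<open>h\<close> gives a homomorphism \<open>v\<close> to the integers whose kernel is torsion.\<close>

lemma commute_if_finitely_many_cosets:
  assumes x: "x \<in> carrier G" "x \<otimes> z = z \<otimes> x"
    and y: "y \<in> carrier G" "y \<otimes> z = z \<otimes> y"
    and z: "z \<in> carrier G" "z \<noteq> \<one>"
    and T: "T \<subseteq> carrier G" "T \<noteq> {}" "\<And>g. g \<in> T \<Longrightarrow> power_coset z g \<subseteq> T"
    and fin: "finite (power_coset z ` T)"
    and xT: "\<And>g. g \<in> T \<Longrightarrow> x \<otimes> g \<in> T" and yT: "\<And>g. g \<in> T \<Longrightarrow> y \<otimes> g \<in> T"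
  shows "x \<otimes> y = y \<otimes> x"
proof -
  \<comment> \<open>The choice is made from the coset itself, so \<open>r\<close> is constant on
    cosets and \<open>R\<close> contains exactly one representative of each coset in
    \<open>T\<close>.\<close>
  define r where "r g = (SOME h. h \<in> power_coset z g)" for g
  define R where "R = r ` T"
  have r_in: "r g \<in> power_coset z g" if "g \<in> carrier G" for g
    unfolding r_def using that by (meson self_in_power_coset someI)
  have r_carrier: "r g \<in> carrier G" if "g \<in> carrier G" for g
    using that r_in power_coset_subset z(1) by blast
  have coset_r: "power_coset z (r g) = power_coset z g" if "g \<in> carrier G" for g
    using that r_in power_coset_eq z(1) by blast
  have r_cong: "r g = r h" if "power_coset z g = power_coset z h" for g h
    using that by (simp add: r_def)
  have "\<exists>n::int. g = z [^] n \<otimes> r g" if "g \<in> carrier G" for g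
  proof -
    have "g \<in> power_coset z (r g)" using that coset_r self_in_power_coset by metis
    then show ?thesis by (auto simp: power_coset_def)
  qed
  then obtain \<alpha> :: "'a \<Rightarrow> int" where \<alpha>: "g = z [^] \<alpha> g \<otimes> r g" if "g \<in> carrier G" for g
    by metis
  have r_shift: "r (z [^] (n::int) \<otimes> g) = r g" if "g \<in> carrier G" for g n
    by (rule r_cong[OF power_coset_shift[OF z(1) that]])
  have \<alpha>_shift: "\<alpha> (z [^] (n::int) \<otimes> g) = n + \<alpha> g" if g: "g \<in> carrier G" for g n
  proof -
    have "z [^] \<alpha> (z [^] n \<otimes> g) \<otimes> r g = z [^] n \<otimes> g"
      using \<alpha>[of "z [^] n \<otimes> g", symmetric] g z(1) by (simp add: r_shift)
    also have "\<dots> = z [^] (n + \<alpha> g) \<otimes> r g"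
      using \<alpha>[OF g] g z(1) r_carrier[OF g] by (metis int_pow_closed int_pow_mult m_assoc)
    finally show ?thesis using g z r_carrier[OF g] int_pow_inj by (metis int_pow_closed right_cancel)
  qed
  have rT: "r g \<in> T" if "g \<in> T" for g using that T r_in by blast
  have RT: "R \<subseteq> T" using rT by (auto simp: R_def)
  have rr: "r \<rho> = \<rho>" if \<rho>: "\<rho> \<in> R" for \<rho>
  proof -
    obtain g where g: "g \<in> T" "\<rho> = r g" using \<rho> unfolding R_def by blast
    then have "g \<in> carrier G" using T(1) by blast
    then show ?thesis unfolding g(2) by (rule r_cong[OF coset_r])
  qed
  have "finite R"
  proof -
    have "R = (\<lambda>\<kappa>. SOME h. h \<in> \<kappa>) ` power_coset z ` T" by (auto simp: R_def r_def)
    then show ?thesis using fin by simp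
  qed
  have "R \<noteq> {}" using T by (simp add: R_def)
  \<comment> \<open>Commuting with \<open>z\<close> makes \<open>h\<close> act on the cosets;
    preserving \<open>T\<close> makes it act on the finitely many cosets in
    \<open>T\<close>.\<close>
  define good where "good h \<longleftrightarrow> h \<in> carrier G \<and> h \<otimes> z = z \<otimes> h \<and> (\<forall>g\<in>T. h \<otimes> g \<in> T)" for h
  have good_mult: "good (h \<otimes> h')" if h: "good h" and h': "good h'" for h h'
  proof -
    have c: "h \<in> carrier G" "h' \<in> carrier G" using h h' by (auto simp: good_def)
    have "h \<otimes> h' \<otimes> z = h \<otimes> (z \<otimes> h')" using h' c z(1) by (simp add: good_def m_assoc)
    also have "\<dots> = (h \<otimes> z) \<otimes> h'" using c z(1) by (simp add: m_assoc)
    also have "\<dots> = z \<otimes> (h \<otimes> h')" using h c z(1) by (simp add: good_def m_assoc)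
    finally have "h \<otimes> h' \<otimes> z = z \<otimes> (h \<otimes> h')" .
    moreover have "h \<otimes> h' \<otimes> g \<in> T" if "g \<in> T" for g
    proof -
      have "g \<in> carrier G" using that T(1) by blast
      then show ?thesis using that h h' c by (simp add: good_def m_assoc)
    qed
    ultimately show ?thesis using c by (simp add: good_def)
  qed
  have commute: "h \<otimes> (z [^] (n::int) \<otimes> g) = z [^] n \<otimes> (h \<otimes> g)"
    if "good h" "g \<in> carrier G" for h g n
    using that z(1) int_pow_commutes[of h z n] unfolding good_def by (simp flip: m_assoc)
  have perm: "bij_betw (\<lambda>\<rho>. r (h \<otimes> \<rho>)) R R" if h: "good h" for h
  proof -
    have hc: "h \<in> carrier G" using h by (simp add: good_def)
    have "inj_on (\<lambda>\<rho>. r (h \<otimes> \<rho>)) R"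
    proof (rule inj_onI)
      fix \<rho> \<sigma> assume \<rho>: "\<rho> \<in> R" and \<sigma>: "\<sigma> \<in> R" and eq: "r (h \<otimes> \<rho>) = r (h \<otimes> \<sigma>)"
      have c: "\<rho> \<in> carrier G" "\<sigma> \<in> carrier G" using \<rho> \<sigma> RT T(1) by blast+
      have "h \<otimes> \<rho> \<in> power_coset z (h \<otimes> \<sigma>)"
        using eq c hc coset_r self_in_power_coset by (metis m_closed)
      then obtain n :: int where "h \<otimes> \<rho> = z [^] n \<otimes> (h \<otimes> \<sigma>)" by (auto simp: power_coset_def)
      then have "h \<otimes> \<rho> = h \<otimes> (z [^] n \<otimes> \<sigma>)" using commute[OF h c(2)] by simp
      then have "\<rho> = z [^] n \<otimes> \<sigma>" using c hc z(1) by simp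
      then show "\<rho> = \<sigma>" using r_shift c(2) rr \<rho> \<sigma> by metis
    qed
    moreover have "(\<lambda>\<rho>. r (h \<otimes> \<rho>)) ` R \<subseteq> R"
      using h RT unfolding good_def R_def by blast
    ultimately show ?thesis using \<open>finite R\<close> by (simp add: bij_betw_def endo_inj_surj)
  qed
  \<comment> \<open>Only forward invariance of \<open>T\<close> is given. Surjectivity of the
    permutation of \<open>R\<close> supplies invariance under the inverse, which the commutator
    below requires.\<close>
  have good_inv: "good (inv h)" if h: "good h" for h
  proof -
    have hc: "h \<in> carrier G" using h by (simp add: good_def)
    have "inv h \<otimes> z = z \<otimes> inv h"
      using h hc z(1) unfolding good_def
      by (metis inv_solve_left inv_solve_right m_assoc inv_closed m_closed)
    moreover have "inv h \<otimes> g \<in> T" if g: "g \<in> T" for g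
    proof -
      have gc: "g \<in> carrier G" using g T(1) by blast
      obtain \<rho> where \<rho>: "\<rho> \<in> R" "r (h \<otimes> \<rho>) = r g"
        using perm[OF h] g unfolding bij_betw_def R_def by (metis (no_types, lifting) imageE imageI)
      have \<rho>c: "\<rho> \<in> carrier G" using \<rho>(1) RT T(1) by blast
      have "g \<in> power_coset z (h \<otimes> \<rho>)"
        using \<rho>(2) \<rho>c gc hc coset_r self_in_power_coset by (metis m_closed)
      then obtain n :: int where "g = z [^] n \<otimes> (h \<otimes> \<rho>)" by (auto simp: power_coset_def)
      then have "g = h \<otimes> (z [^] n \<otimes> \<rho>)" using commute[OF h \<rho>c] by simp
      then have "inv h \<otimes> g = z [^] n \<otimes> \<rho>"
        using hc \<rho>c z(1) by (metis inv_solve_left int_pow_closed m_closed)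
      then show ?thesis using T(3)[of \<rho>] \<rho>(1) RT by (auto simp: power_coset_def)
    qed
    ultimately show ?thesis using hc by (simp add: good_def)
  qed
  define v where "v h = (\<Sum>\<rho>\<in>R. \<alpha> (h \<otimes> \<rho>) - \<alpha> \<rho>)" for h
  \<comment> \<open>As \<open>h\<close> commutes with \<open>z\<close>, replacing \<open>g\<close>
    by another element of its coset shifts both exponents equally. So the sum \<open>v\<close> may
    be taken over any system of representatives, which gives additivity.\<close>
  have cocycle: "\<alpha> (h \<otimes> r g) - \<alpha> (r g) = \<alpha> (h \<otimes> g) - \<alpha> g" if h: "good h" and g: "g \<in> T" for h g
  proof -
    have gc: "g \<in> carrier G" using g T(1) by blast
    have hc: "h \<in> carrier G" using h by (simp add: good_def)
    have "h \<otimes> g = z [^] \<alpha> g \<otimes> (h \<otimes> r g)"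
      using \<alpha>[OF gc] commute[OF h r_carrier[OF gc]] by metis
    then have "\<alpha> (h \<otimes> g) = \<alpha> g + \<alpha> (h \<otimes> r g)"
      using \<alpha>_shift[of "h \<otimes> r g" "\<alpha> g"] hc r_carrier[OF gc] by simp
    moreover have "\<alpha> g = \<alpha> g + \<alpha> (r g)"
      using \<alpha>_shift[of "r g" "\<alpha> g"] r_carrier[OF gc] \<alpha>[OF gc, symmetric] by simp
    ultimately show ?thesis by simp
  qed
  have v_mult: "v (h \<otimes> h') = v h + v h'" if h: "good h" and h': "good h'" for h h'
  proof -
    have "v h = (\<Sum>\<rho>\<in>R. \<alpha> (h \<otimes> r (h' \<otimes> \<rho>)) - \<alpha> (r (h' \<otimes> \<rho>)))"
      unfolding v_def by (rule sum.reindex_bij_betw[OF perm[OF h'], symmetric])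
    also have "\<dots> = (\<Sum>\<rho>\<in>R. \<alpha> (h \<otimes> (h' \<otimes> \<rho>)) - \<alpha> (h' \<otimes> \<rho>))"
      using h' RT by (intro sum.cong refl cocycle[OF h]) (auto simp: good_def)
    finally have "v h + v h' = (\<Sum>\<rho>\<in>R. \<alpha> (h \<otimes> (h' \<otimes> \<rho>)) - \<alpha> \<rho>)"
      unfolding v_def by (simp flip: sum.distrib)
    also have "\<dots> = v (h \<otimes> h')"
      unfolding v_def using h h' RT T(1) by (intro sum.cong) (auto simp: good_def m_assoc)
    finally show ?thesis ..
  qed
  have good_one: "good \<one>" using z(1) T(1) by (auto simp: good_def)
  have good_pow: "good (h [^] (n::nat)) \<and> v (h [^] n) = int n * v h" if "good h" for h n
  proof (induction n)
    case 0
    show ?case using v_mult[OF good_one good_one] good_one by simp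
  next
    case (Suc n)
    then show ?case using that good_mult v_mult by (simp add: algebra_simps)
  qed
  define w where "w = x \<otimes> y \<otimes> inv (y \<otimes> x)"
  have gx: "good x" and gy: "good y" using x y xT yT by (auto simp: good_def)
  have gw: "good w" unfolding w_def using gx gy good_mult good_inv by blast
  have wc: "w \<in> carrier G" using gw by (simp add: good_def)
  have wyx: "w \<otimes> (y \<otimes> x) = x \<otimes> y" using x y by (simp add: w_def m_assoc)
  then have "v w = 0"
    using v_mult[OF gw good_mult[OF gy gx]] v_mult[OF gx gy] v_mult[OF gy gx] by simp
  obtain \<rho> where \<rho>: "\<rho> \<in> R" using \<open>R \<noteq> {}\<close> by blast
  have \<rho>c: "\<rho> \<in> carrier G" using \<rho> RT T(1) by blast
  \<comment> \<open>Two powers of the commutator \<open>w\<close> send the representative into the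
    same coset, so some positive power of \<open>w\<close> is a power \<open>z [^] n\<close>. There
    \<open>v\<close> is both 0 and \<open>n\<close> times the number of cosets, hence
    \<open>n = 0\<close> and \<open>w\<close> is torsion.\<close>
  have "range (\<lambda>n::nat. r (w [^] n \<otimes> \<rho>)) \<subseteq> R"
    using good_pow[OF gw] \<rho> RT unfolding good_def R_def by blast
  then have "\<not> inj (\<lambda>n::nat. r (w [^] n \<otimes> \<rho>))"
    using \<open>finite R\<close> by (meson finite_subset range_inj_infinite)
  then obtain p q :: nat where pq: "p < q" "r (w [^] p \<otimes> \<rho>) = r (w [^] q \<otimes> \<rho>)"
    unfolding inj_def by (metis linorder_neqE_nat)
  have "w [^] q \<otimes> \<rho> \<in> power_coset z (w [^] p \<otimes> \<rho>)"
    using pq(2) wc \<rho>c coset_r self_in_power_coset by (metis m_closed nat_pow_closed)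
  then obtain n :: int where "w [^] q \<otimes> \<rho> = z [^] n \<otimes> (w [^] p \<otimes> \<rho>)"
    by (auto simp: power_coset_def)
  then have "w [^] q = z [^] n \<otimes> w [^] p"
    using wc z(1) \<rho>c by (metis int_pow_closed m_assoc m_closed nat_pow_closed right_cancel)
  moreover have "w [^] q = w [^] (q - p) \<otimes> w [^] p"
    using pq(1) wc by (simp add: nat_pow_mult)
  ultimately have wz: "w [^] (q - p) = z [^] n"
    using wc z(1) by (metis int_pow_closed nat_pow_closed right_cancel)
  have "0 = v (z [^] n)" using good_pow[OF gw, of "q - p"] \<open>v w = 0\<close> wz by simp
  also have "\<dots> = (\<Sum>\<rho>\<in>R. n)"
    unfolding v_def using \<alpha>_shift RT T(1) by (intro sum.cong) auto
  finally have "n = 0" using \<open>finite R\<close> \<open>R \<noteq> {}\<close> by simp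
  then have "w = \<one>" using torsion_free[OF wc, of "q - p"] wz pq(1) by simp
  then show ?thesis using wyx x y by simp
qed

section \<open>Sets consisting of few progressions\<close>

text \<open>Since \<open>x\<close> has infinite order and \<open>B\<close> is finite, the powers of
  \<open>x\<close> carry \<open>b\<close> out of \<open>B\<close>; \<open>t\<close> is the last
  index before the first exit. The elements of \<open>B\<close> that \<open>x\<close> moves out of
  \<open>B\<close> are thus the ends of its maximal \<open>x\<close>-progressions, and counting them
  counts the progressions.\<close>

lemma chain_end:
  assumes x: "x \<in> carrier G" "x \<noteq> \<one>" and B: "B \<subseteq> carrier G" "finite B" and "b \<in> B"
  shows "\<exists>t::nat. (\<forall>s\<le>t. x [^] s \<otimes> b \<in> B) \<and> x \<otimes> (x [^] t \<otimes> b) \<notin> B"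
proof -
  have b: "b \<in> carrier G" using B \<open>b \<in> B\<close> by blast
  have "\<exists>t::nat. x [^] t \<otimes> b \<notin> B"
  proof (rule ccontr)
    assume "\<not> ?thesis"
    then have "range (\<lambda>t::nat. x [^] t \<otimes> b) \<subseteq> B" by blast
    moreover have "inj (\<lambda>t::nat. x [^] t \<otimes> b)"
      using b x nat_pow_inj[OF x] by (auto intro!: injI)
    ultimately show False
      using \<open>finite B\<close> by (meson finite_subset range_inj_infinite)
  qed
  moreover define u where "u = (LEAST t::nat. x [^] t \<otimes> b \<notin> B)"
  ultimately have u: "x [^] u \<otimes> b \<notin> B" "\<And>s. s < u \<Longrightarrow> x [^] s \<otimes> b \<in> B"
    using not_less_Least LeastI_ex[of "\<lambda>t::nat. x [^] t \<otimes> b \<notin> B"] by blast+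
  then have "u \<noteq> 0" using b \<open>b \<in> B\<close> by (metis l_one nat_pow_0)
  then obtain t where t: "u = Suc t" using not0_implies_Suc by blast
  have "x [^] u \<otimes> b = x \<otimes> (x [^] t \<otimes> b)"
    unfolding t using x(1) b by (metis m_assoc nat_pow_Suc2 nat_pow_closed)
  then show ?thesis using u t by (metis less_Suc_eq_le)
qed

text \<open>An element is determined by the end of its progression and its distance from that end.
  If all distances were below \<open>m\<close>, there would be too few such pairs.\<close>

lemma exists_long_chain:
  assumes x: "x \<in> carrier G" "x \<noteq> \<one>" and B: "B \<subseteq> carrier G" "finite B"
    and m: "card {b \<in> B. x \<otimes> b \<notin> B} * m < card B"
  obtains b where "b \<in> B" "\<And>s. s \<le> m \<Longrightarrow> x [^] s \<otimes> b \<in> B"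
proof -
  define E where "E = {b \<in> B. x \<otimes> b \<notin> B}"
  obtain t :: "'a \<Rightarrow> nat" where
    t: "\<And>b s. b \<in> B \<Longrightarrow> s \<le> t b \<Longrightarrow> x [^] s \<otimes> b \<in> B"
      "\<And>b. b \<in> B \<Longrightarrow> x \<otimes> (x [^] t b \<otimes> b) \<notin> B"
    using chain_end[OF x B] by metis
  have "\<exists>b\<in>B. m \<le> t b"
  proof (rule ccontr)
    assume "\<not> ?thesis"
    then have "(\<lambda>b. (x [^] t b \<otimes> b, t b)) ` B \<subseteq> E \<times> {..<m}"
      using t by (force simp: E_def not_le)
    moreover have "inj_on (\<lambda>b. (x [^] t b \<otimes> b, t b)) B"
      using B(1) x(1) by (auto simp: subset_iff intro!: inj_onI)
    ultimately have "card B \<le> card (E \<times> {..<m})"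
      using B(2) by (intro card_inj_on_le[of "\<lambda>b. (x [^] t b \<otimes> b, t b)"]) (auto simp: E_def)
    then show False using m by (simp add: E_def card_cartesian_product)
  qed
  then obtain b where "b \<in> B" "m \<le> t b" by blast
  then show ?thesis using t(1) that[of b] by auto
qed

text \<open>Each of the \<open>m + 1\<close> elements \<open>x [^] s \<otimes> b\<close> runs along
  powers of \<open>y\<close> to one of at most \<open>m\<close> ends. Two of them share an end, and
  cancelling \<open>b\<close> leaves a relation between powers of \<open>x\<close> and
  \<open>y\<close>.\<close>

lemma chains_meet:
  assumes x: "x \<in> carrier G" "x \<noteq> \<one>" and y: "y \<in> carrier G" "y \<noteq> \<one>"
    and B: "B \<subseteq> carrier G" "finite B"
    and b: "\<And>s. s \<le> m \<Longrightarrow> x [^] s \<otimes> b \<in> B" "b \<in> carrier G"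
    and m: "card {b \<in> B. y \<otimes> b \<notin> B} \<le> m"
  obtains i :: nat and j :: int where "0 < i" "i \<le> m" "j \<noteq> 0" "x [^] i = y [^] j"
proof -
  define E where "E = {b \<in> B. y \<otimes> b \<notin> B}"
  have "\<exists>t::nat. y [^] t \<otimes> c \<in> E" if "c \<in> B" for c
    using chain_end[OF y B that] unfolding E_def by blast
  then obtain t :: "'a \<Rightarrow> nat" where t: "\<And>c. c \<in> B \<Longrightarrow> y [^] t c \<otimes> c \<in> E" by metis
  define e where "e s = y [^] t (x [^] s \<otimes> b) \<otimes> (x [^] s \<otimes> b)" for s :: nat
  have "e ` {..m} \<subseteq> E" using t b(1) by (auto simp: e_def)
  then have "card (e ` {..m}) \<le> m"
    using card_mono[of E "e ` {..m}"] B(2) m unfolding E_def by simp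
  then have "\<not> inj_on e {..m}" using card_image[of e "{..m}"] by auto
  then obtain p q where pq: "p < q" "q \<le> m" "e p = e q"
    unfolding inj_on_def by (metis atMost_iff linorder_neqE_nat)
  define u u' where "u = int (t (x [^] p \<otimes> b))" and "u' = int (t (x [^] q \<otimes> b))"
  have "y [^] u \<otimes> (x [^] p \<otimes> b) = y [^] u' \<otimes> (x [^] q \<otimes> b)"
    using pq(3) by (simp add: e_def u_def u'_def int_pow_int)
  then have "y [^] u \<otimes> x [^] p = y [^] u' \<otimes> x [^] q"
    using x y b(2) by (simp flip: m_assoc)
  moreover have "x [^] q = x [^] (q - p) \<otimes> x [^] p"
    using x pq by (simp add: nat_pow_mult)
  ultimately have "y [^] u = y [^] u' \<otimes> x [^] (q - p)"
    using x y by (simp flip: m_assoc)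
  then have "x [^] (q - p) = inv (y [^] u') \<otimes> y [^] u"
    using x y by (simp add: inv_solve_left)
  then have eq: "x [^] (q - p) = y [^] (u - u')"
    using y by (simp add: int_pow_neg[symmetric] int_pow_mult[symmetric])
  \<comment> \<open>Torsion-freeness excludes the exponent 0 on the side of
    \<open>y\<close>.\<close>
  have "x [^] (q - p) \<noteq> \<one>" using pq x torsion_free[of x "q - p"] by auto
  then have "u - u' \<noteq> 0" using eq by (metis int_pow_0)
  then show ?thesis using that[of "q - p" "u - u'"] eq pq by auto
qed

text \<open>Modulo \<open>x [^] i\<close> only the remainder mod \<open>i\<close> of the distance to
  the end of a progression matters. So \<open>B\<close> meets at most \<open>i\<close> cosets per
  progression, and one of them holds more than the average.\<close>

lemma large_coset:
  assumes x: "x \<in> carrier G" "x \<noteq> \<one>" and B: "B \<subseteq> carrier G" "finite B"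
    and i: "0 < i" and card: "card {b \<in> B. x \<otimes> b \<notin> B} * i * N < card B"
  obtains b where "b \<in> B" "N < card (B \<inter> power_coset (x [^] (i::nat)) b)"
proof -
  define z where "z = x [^] i"
  define E where "E = {b \<in> B. x \<otimes> b \<notin> B}"
  define K where "K = power_coset z ` B"
  have zc: "z \<in> carrier G" using x by (simp add: z_def)
  have "K \<subseteq> (\<lambda>(e, u). power_coset z (inv (x [^] u) \<otimes> e)) ` (E \<times> {..<i})"
  proof -
    have "\<exists>e\<in>E. \<exists>u<i. power_coset z b = power_coset z (inv (x [^] u) \<otimes> e)" if b: "b \<in> B" for b
    proof -
      have bc: "b \<in> carrier G" using b B by blast
      obtain t :: nat where t: "\<And>s. s \<le> t \<Longrightarrow> x [^] s \<otimes> b \<in> B" "x \<otimes> (x [^] t \<otimes> b) \<notin> B"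
        using chain_end[OF x B b] by metis
      have "x [^] t = x [^] (t mod i + i * (t div i))" by simp
      also have "\<dots> = x [^] (t mod i) \<otimes> z [^] int (t div i)"
        using x by (simp add: z_def int_pow_int nat_pow_pow nat_pow_mult)
      finally have "inv (x [^] (t mod i)) \<otimes> (x [^] t \<otimes> b) = z [^] int (t div i) \<otimes> b"
        using x zc bc by (simp flip: m_assoc)
      then have "power_coset z (inv (x [^] (t mod i)) \<otimes> (x [^] t \<otimes> b)) = power_coset z b"
        using power_coset_shift[OF zc bc] by simp
      moreover have "x [^] t \<otimes> b \<in> E" using t by (simp add: E_def)
      moreover have "t mod i < i" using i by simp
      ultimately show ?thesis by metis
    qed
    then show ?thesis unfolding K_def by fastforce
  qed
  then have "card K \<le> card (E \<times> {..<i})"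
    using B(2) by (intro surj_card_le) (auto simp: E_def)
  then have cK: "card K \<le> card E * i" by (simp add: card_cartesian_product)
  have "\<exists>\<kappa>\<in>K. N < card (B \<inter> \<kappa>)"
  proof (rule ccontr)
    assume "\<not> ?thesis"
    then have le: "card (B \<inter> \<kappa>) \<le> N" if "\<kappa> \<in> K" for \<kappa> using that by (simp add: not_less)
    have "B = (\<Union>\<kappa>\<in>K. B \<inter> \<kappa>)" using B(1) self_in_power_coset by (auto simp: K_def)
    then have "card B \<le> (\<Sum>\<kappa>\<in>K. card (B \<inter> \<kappa>))"
      using card_UN_le[of K "\<lambda>\<kappa>. B \<inter> \<kappa>"] B(2) by (simp add: K_def)
    also have "\<dots> \<le> card K * N" using sum_bounded_above[of K "\<lambda>\<kappa>. card (B \<inter> \<kappa>)" N] le by simp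
    also have "\<dots> \<le> card E * i * N" using cK by simp
    finally show False using card by (simp add: E_def)
  qed
  then show ?thesis using that by (auto simp: K_def z_def)
qed

text \<open>Multiplication by \<open>x\<close> injects the elements of
  \<open>B \<inter> \<kappa>\<close> other than progression ends into the translated coset, so the
  drop at \<open>\<kappa>\<close> is at most the number of ends in \<open>\<kappa>\<close>.
  Subtraction is truncated: an increase counts as drop 0 and cannot offset drops elsewhere.\<close>

lemma coset_drop_le:
  assumes x: "x \<in> carrier G" and B: "B \<subseteq> carrier G" "finite B"
    and z: "z \<in> carrier G" 
  shows "(\<Sum>\<kappa>\<in>power_coset z ` B. card (B \<inter> \<kappa>) - card (B \<inter> (\<otimes>) x ` \<kappa>)) \<le> card {b \<in> B. x \<otimes> b \<notin> B}"
proof -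
  define E where "E = {b \<in> B. x \<otimes> b \<notin> B}"
  have "card (B \<inter> \<kappa>) - card (B \<inter> (\<otimes>) x ` \<kappa>) \<le> card (E \<inter> \<kappa>)" if "\<kappa> \<in> power_coset z ` B" for \<kappa>
  proof -
    have "card (B \<inter> \<kappa> - E) \<le> card (B \<inter> (\<otimes>) x ` \<kappa>)"
      using B x by (intro card_inj_on_le[of "(\<otimes>) x"]) (auto simp: E_def subset_iff intro!: inj_onI)
    moreover have "card (B \<inter> \<kappa> - E) = card (B \<inter> \<kappa>) - card (E \<inter> \<kappa>)"
    proof -
      have "B \<inter> \<kappa> \<inter> E = E \<inter> \<kappa>" by (auto simp: E_def)
      moreover have "finite E" using B(2) by (simp add: E_def)
      ultimately show ?thesis using card_Diff_subset_Int[of "B \<inter> \<kappa>" E] by simp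
    qed
    ultimately show ?thesis by linarith
  qed
  then have "(\<Sum>\<kappa>\<in>power_coset z ` B. card (B \<inter> \<kappa>) - card (B \<inter> (\<otimes>) x ` \<kappa>))
      \<le> (\<Sum>\<kappa>\<in>power_coset z ` B. card (E \<inter> \<kappa>))"
    by (rule sum_mono)
  also have "\<dots> = card (\<Union>\<kappa>\<in>power_coset z ` B. E \<inter> \<kappa>)"
  proof (rule card_UN_disjoint[symmetric])
    show "\<forall>i\<in>power_coset z ` B. \<forall>j\<in>power_coset z ` B. i \<noteq> j \<longrightarrow> E \<inter> i \<inter> (E \<inter> j) = {}"
    proof (intro ballI impI)
      fix i j assume "i \<in> power_coset z ` B" "j \<in> power_coset z ` B" "i \<noteq> j"
      then have "i \<inter> j = {}" using power_coset_disjoint[OF z] B(1) by blast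
      then show "E \<inter> i \<inter> (E \<inter> j) = {}" by blast
    qed
  qed (use B(2) in \<open>auto simp: E_def\<close>)
  also have "\<dots> \<le> card E" using B(2) by (intro card_mono) (auto simp: E_def)
  finally show ?thesis by (simp add: E_def)
qed

text \<open>A level is bad if passing from some coset to its translate by \<open>x\<close> or
  \<open>y\<close> falls from at least that level to below it. The number of bad levels is bounded
  by the total drop, which is less than the size at \<open>b\<close>, so a good positive level
  remains.\<close>

lemma level_set_invariant:
  assumes x: "x \<in> carrier G" "x \<otimes> z = z \<otimes> x"
    and y: "y \<in> carrier G" "y \<otimes> z = z \<otimes> y" and z: "z \<in> carrier G"
    and B: "B \<subseteq> carrier G" "finite B" and b: "b \<in> B"
    and large: "card {b \<in> B. x \<otimes> b \<notin> B} + card {b \<in> B. y \<otimes> b \<notin> B} < card (B \<inter> power_coset z b)"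
  obtains \<tau> where "0 < \<tau>" "\<tau> \<le> card (B \<inter> power_coset z b)"
    "\<And>g. \<lbrakk>g \<in> carrier G; \<tau> \<le> card (B \<inter> power_coset z g)\<rbrakk>
      \<Longrightarrow> \<tau> \<le> card (B \<inter> power_coset z (x \<otimes> g)) \<and> \<tau> \<le> card (B \<inter> power_coset z (y \<otimes> g))"
proof -
  define K where "K = power_coset z ` B"
  define M where "M = card (B \<inter> power_coset z b)"
  \<comment> \<open>The levels crossed on passing from \<open>\<kappa>\<close> to its translate by
    \<open>h\<close>; their number is the truncated drop.\<close>
  define D where "D h \<kappa> = {card (B \<inter> (\<otimes>) h ` \<kappa>) <.. card (B \<inter> \<kappa>)}" for h \<kappa>
  have finK: "finite K" using B by (simp add: K_def)
  have card_D: "card (\<Union>\<kappa>\<in>K. D h \<kappa>) \<le> card {b \<in> B. h \<otimes> b \<notin> B}" if "h \<in> carrier G" for h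
  proof -
    have "card (\<Union>\<kappa>\<in>K. D h \<kappa>) \<le> (\<Sum>\<kappa>\<in>K. card (D h \<kappa>))" by (rule card_UN_le[OF finK])
    then show ?thesis using coset_drop_le[OF that B z] by (simp add: D_def K_def)
  qed
  have "card ((\<Union>\<kappa>\<in>K. D x \<kappa>) \<union> (\<Union>\<kappa>\<in>K. D y \<kappa>)) < M"
    using card_Un_le[of "\<Union>\<kappa>\<in>K. D x \<kappa>" "\<Union>\<kappa>\<in>K. D y \<kappa>"] card_D[OF x(1)] card_D[OF y(1)] large
    unfolding M_def by linarith
  then have "\<not> {0<..M} \<subseteq> (\<Union>\<kappa>\<in>K. D x \<kappa>) \<union> (\<Union>\<kappa>\<in>K. D y \<kappa>)"
    using card_mono[of "(\<Union>\<kappa>\<in>K. D x \<kappa>) \<union> (\<Union>\<kappa>\<in>K. D y \<kappa>)" "{0<..M}"] finK by (auto simp: D_def)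
  then obtain \<tau> where \<tau>: "0 < \<tau>" "\<tau> \<le> M" "\<And>\<kappa>. \<kappa> \<in> K \<Longrightarrow> \<tau> \<notin> D x \<kappa> \<and> \<tau> \<notin> D y \<kappa>"
    unfolding subset_iff by (metis UN_I Un_iff greaterThanAtMost_iff)
  show ?thesis
  proof (rule that[of \<tau>])
    fix g assume g: "g \<in> carrier G" and le: "\<tau> \<le> card (B \<inter> power_coset z g)"
    then have "B \<inter> power_coset z g \<noteq> {}" using \<tau>(1) by auto
    then obtain c where c: "c \<in> B" "c \<in> power_coset z g" by blast
    then have "power_coset z g \<in> K" using power_coset_eq[OF z g c(2)] by (auto simp: K_def)
    from \<tau>(3)[OF this] le
    show "\<tau> \<le> card (B \<inter> power_coset z (x \<otimes> g)) \<and> \<tau> \<le> card (B \<inter> power_coset z (y \<otimes> g))"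
      using power_coset_image[OF x(1) z g x(2)] power_coset_image[OF y(1) z g y(2)]
      by (auto simp: D_def)
  qed (use \<tau> in \<open>auto simp: M_def\<close>)
qed

lemma few_chains_imp_commensurable:
  assumes x: "x \<in> carrier G" "x \<noteq> \<one>" and y: "y \<in> carrier G" "y \<noteq> \<one>"
    and B: "B \<subseteq> carrier G" "finite B"
    and mx: "card {b \<in> B. x \<otimes> b \<notin> B} \<le> m" and my: "card {b \<in> B. y \<otimes> b \<notin> B} \<le> m"
    and card: "2 * m ^ 3 < card B"
  shows "x \<otimes> y = y \<otimes> x \<and> (\<exists>(i::int) (j::int). i \<noteq> 0 \<and> j \<noteq> 0 \<and> x [^] i = y [^] j)"
proof -
  have "m * m \<le> 2 * m ^ 3" by (cases m) (simp_all add: power3_eq_cube)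
  then have "card {b \<in> B. x \<otimes> b \<notin> B} * m < card B"
    using card mx mult_le_mono1[OF mx, of m] by linarith
  then obtain b where b: "b \<in> B" "\<And>s. s \<le> m \<Longrightarrow> x [^] s \<otimes> b \<in> B"
    using exists_long_chain[OF x B] by blast
  have "b \<in> carrier G" using b(1) B(1) by blast
  from chains_meet[OF x y B b(2) this my]
  obtain i and j :: int where ij: "0 < i" "i \<le> m" "j \<noteq> 0" "x [^] i = y [^] j" by blast
  define z where "z = x [^] i"
  have z: "z \<in> carrier G" "z \<noteq> \<one>"
    using x ij(1) torsion_free[of x i] by (auto simp: z_def)
  \<comment> \<open>Being a power of \<open>x\<close> and also of \<open>y\<close>, the element
    \<open>z\<close> commutes with both.\<close>
  have xz: "x \<otimes> z = z \<otimes> x"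
    using int_pow_commutes[of x x "int i"] x by (simp add: z_def int_pow_int)
  have yz: "y \<otimes> z = z \<otimes> y"
    using int_pow_commutes[of y y j] y by (simp add: z_def ij(4))
  \<comment> \<open>One factor \<open>m\<close> bounds the progressions, one bounds
    \<open>i\<close>, and \<open>2 * m\<close> is the combined drop for \<open>x\<close> and
    \<open>y\<close> that has to be exceeded.\<close>
  have "card {b \<in> B. x \<otimes> b \<notin> B} * i * (2 * m) \<le> m * m * (2 * m)"
    using mx ij(2) by (intro mult_le_mono) auto
  also have "\<dots> < card B" using card by (simp add: power3_eq_cube mult_ac)
  finally obtain c where c: "c \<in> B" "2 * m < card (B \<inter> power_coset z c)"
    using large_coset[OF x B ij(1)] unfolding z_def by blast
  then have "card {b \<in> B. x \<otimes> b \<notin> B} + card {b \<in> B. y \<otimes> b \<notin> B} < card (B \<inter> power_coset z c)"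
    using mx my by linarith
  from level_set_invariant[OF x(1) xz y(1) yz z(1) B c(1) this]
  obtain \<tau> where \<tau>: "0 < \<tau>" "\<tau> \<le> card (B \<inter> power_coset z c)"
    "\<And>g. \<lbrakk>g \<in> carrier G; \<tau> \<le> card (B \<inter> power_coset z g)\<rbrakk>
      \<Longrightarrow> \<tau> \<le> card (B \<inter> power_coset z (x \<otimes> g)) \<and> \<tau> \<le> card (B \<inter> power_coset z (y \<otimes> g))"
    by blast
  define T where "T = {g \<in> carrier G. \<tau> \<le> card (B \<inter> power_coset z g)}"
  have "x \<otimes> y = y \<otimes> x"
  proof (rule commute_if_finitely_many_cosets[OF x(1) xz y(1) yz z, of T])
    show "T \<noteq> {}" using c(1) B(1) \<tau>(2) by (auto simp: T_def)
    show "power_coset z g \<subseteq> T" if g: "g \<in> T" for g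
    proof
      fix h assume h: "h \<in> power_coset z g"
      have gc: "g \<in> carrier G" using g by (simp add: T_def)
      have "power_coset z h = power_coset z g" by (rule power_coset_eq[OF z(1) gc h])
      moreover have "h \<in> carrier G" using power_coset_subset[OF z(1) gc] h by blast
      ultimately show "h \<in> T" using g by (simp add: T_def)
    qed
    \<comment> \<open>Because \<open>\<tau>\<close> is positive, every coset in \<open>T\<close>
      meets the finite set \<open>B\<close>.\<close>
    have "power_coset z g \<in> power_coset z ` B" if g: "g \<in> T" for g
    proof -
      have "B \<inter> power_coset z g \<noteq> {}" using g \<tau>(1) by (auto simp: T_def)
      then obtain c where c: "c \<in> B" "c \<in> power_coset z g" by blast
      then have "power_coset z g = power_coset z c"
        using g power_coset_eq[OF z(1), of g c] by (simp add: T_def)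
      then show ?thesis using c(1) by simp
    qed
    then show "finite (power_coset z ` T)"
      using finite_subset[of "power_coset z ` T" "power_coset z ` B"] B(2) by blast
  qed (use \<tau>(3) x(1) y(1) in \<open>auto simp: T_def\<close>)
  moreover have "x [^] int i = y [^] j" using ij(4) by (simp add: int_pow_int)
  moreover have "int i \<noteq> 0" using ij(1) by simp
  ultimately show ?thesis using ij(3) by (intro conjI exI[of _ "int i"] exI[of _ j])
qed

section \<open>Common roots\<close>

text \<open>Torsion-freeness allows division of both exponents by their gcd. With coprime
  \<open>i'\<close>, \<open>j'\<close> and Bezout coefficients \<open>u\<close>, \<open>v\<close>,
  the element \<open>x [^] v \<otimes> y [^] u\<close> has \<open>j'\<close>-th power
  \<open>x\<close> and \<open>i'\<close>-th power \<open>y\<close>.\<close>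

lemma common_root:
  assumes x: "x \<in> carrier G" and y: "y \<in> carrier G" and xy: "x \<otimes> y = y \<otimes> x"
    and ij: "(i::int) \<noteq> 0" "x [^] i = y [^] (j::int)"
  obtains d and p q :: int where "d \<in> carrier G" "x = d [^] p" "y = d [^] q"
proof -
  define g where "g = gcd i j"
  define i' j' where "i' = i div g" and "j' = j div g"
  have g: "g \<noteq> 0" "i = i' * g" "j = j' * g" "coprime i' j'"
    using ij(1) by (auto simp: g_def i'_def j'_def div_gcd_coprime)
  have comm: "x [^] (a::int) \<otimes> y [^] (b::int) = y [^] b \<otimes> x [^] a" for a b
  proof -
    have "y \<otimes> x [^] a = x [^] a \<otimes> y" by (rule int_pow_commutes[OF y x xy[symmetric]])
    then show ?thesis using x y by (intro int_pow_commutes) auto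
  qed
  have "(x [^] i' \<otimes> y [^] (- j')) [^] g = x [^] i \<otimes> y [^] (- j)"
    using x y comm[of i' "- j'"] g by (subst int_pow_mult_distrib) (auto simp: int_pow_pow)
  also have "\<dots> = \<one>" using ij(2) x y by (simp add: int_pow_neg)
  finally have "x [^] i' \<otimes> y [^] (- j') = \<one>" using int_pow_eq_one[OF _ _ g(1)] x y by simp
  then have eq: "x [^] i' = y [^] j'" using x y by (simp add: int_pow_neg inv_solve_right')
  obtain u v where uv: "u * i' + v * j' = 1"
    using bezout_int[of i' j'] g(4) by auto
  define d where "d = x [^] v \<otimes> y [^] u"
  have d: "d \<in> carrier G" using x y by (simp add: d_def)
  have pow_d: "d [^] n = x [^] (v * n) \<otimes> y [^] (u * n)" for n :: int
    unfolding d_def using x y comm[of v u] by (subst int_pow_mult_distrib) (auto simp: int_pow_pow)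
  have "d [^] j' = x [^] (v * j') \<otimes> (y [^] j') [^] u"
    using y by (simp add: pow_d int_pow_pow mult.commute)
  also have "\<dots> = x [^] (v * j' + u * i')"
    using x by (simp add: eq[symmetric] int_pow_pow int_pow_mult mult.commute)
  also have "\<dots> = x" using uv x by (simp add: add.commute)
  finally have dx: "x = d [^] j'" ..
  have "d [^] i' = (x [^] i') [^] v \<otimes> y [^] (u * i')"
    using x by (simp add: pow_d int_pow_pow mult.commute)
  also have "\<dots> = y [^] (v * j' + u * i')"
    using y by (simp add: eq int_pow_pow int_pow_mult mult.commute)
  also have "\<dots> = y" using uv y by (simp add: add.commute)
  finally have "y = d [^] i'" ..
  with dx d that show ?thesis by blast
qed

text \<open>The element \<open>g\<^sup>p\<close> with \<open>p\<close> minimal generates the centralizer of \<open>y\<close> in \<open>\<langle>g\<rangle>\<close>, and it has a common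
  root with \<open>y\<close>.\<close>

lemma powers_of_common_root:
  assumes g: "g \<in> carrier G" and A: "A \<subseteq> range (\<lambda>n::int. g [^] n)"
    and y: "y \<in> carrier G" and comm: "\<And>x. x \<in> A \<Longrightarrow> x \<otimes> y = y \<otimes> x"
    and x: "x \<in> A" "x \<noteq> \<one>" "i \<noteq> 0" "x [^] (i::int) = y [^] (j::int)"
  obtains d where "d \<in> carrier G" "insert y A \<subseteq> range (\<lambda>n::int. d [^] n)"
proof -
  define Q where "Q p \<longleftrightarrow> 0 < p \<and> g [^] (p::nat) \<otimes> y = y \<otimes> g [^] p" for p
  have int_comm: "g [^] (- n) \<otimes> y = y \<otimes> g [^] (- n)" if "g [^] n \<otimes> y = y \<otimes> g [^] n" for n :: int
    using int_pow_commutes[of y "g [^] n" "-1"] that g y by (simp add: int_pow_pow)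
  obtain q :: int where q: "x = g [^] q" using x(1) A by blast
  have "q \<noteq> 0" using x(2) q by auto
  have "g [^] nat \<bar>q\<bar> \<otimes> y = y \<otimes> g [^] nat \<bar>q\<bar>"
    using comm[OF x(1)] int_comm[of q] unfolding q
    by (cases "0 \<le> q") (simp_all flip: int_pow_int)
  then have "Q (nat \<bar>q\<bar>)" using \<open>q \<noteq> 0\<close> by (simp add: Q_def)
  then have ex: "\<exists>p. Q p" by blast
  define p where "p = (LEAST p. Q p)"
  have p: "0 < p" "g [^] p \<otimes> y = y \<otimes> g [^] p" using LeastI_ex[OF ex] by (simp_all add: p_def Q_def)
  have minimal: "\<not> Q r" if "r < p" for r using that not_less_Least unfolding p_def by blast
  define c where "c = g [^] p"
  have c: "c \<in> carrier G" "c \<otimes> y = y \<otimes> c" using g p by (auto simp: c_def)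
  have in_powers: "\<exists>k::int. a = c [^] k" if a: "a \<in> A" for a
  proof -
    obtain n :: int where n: "a = g [^] n" using a A by blast
    define k r where "k = n div int p" and "r = n mod int p"
    have r: "0 \<le> r" "r < int p" using p(1) by (auto simp: r_def)
    \<comment> \<open>Division with remainder: the remainder power equals \<open>a\<close> times a
      power of \<open>c\<close>, so it commutes with \<open>y\<close>, and minimality of
      \<open>p\<close> forces \<open>r = 0\<close>.\<close>
    have "g [^] r = g [^] (n + int p * (- k))"
      by (simp add: r_def k_def minus_div_mult_eq_mod[symmetric] algebra_simps)
    also have "\<dots> = a \<otimes> c [^] (- k)"
      using g unfolding n c_def by (simp only: int_pow_mult int_pow_pow flip: int_pow_int)
    finally have gr: "g [^] r = a \<otimes> c [^] (- k)" .
    have "y \<otimes> c [^] (- k) = c [^] (- k) \<otimes> y" using int_pow_commutes[OF y c(1)] c(2) by simp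
    moreover have ac: "a \<in> carrier G" using n g by simp
    ultimately have "g [^] r \<otimes> y = y \<otimes> g [^] r"
      unfolding gr using comm[OF a] c(1) y by (metis int_pow_closed m_assoc)
    then have "\<not> 0 < nat r" using minimal[of "nat r"] r by (auto simp: Q_def simp flip: int_pow_int)
    then have "r = 0" using r by simp
    then have "a = c [^] k" using gr ac c(1) by (simp add: int_pow_neg inv_solve_right)
    then show ?thesis by blast
  qed
  then obtain k :: int where k: "x = c [^] k" using x(1) by blast
  have "k \<noteq> 0" using k x(2) by auto
  then have "k * i \<noteq> 0" using x(3) by simp
  moreover have "c [^] (k * i) = y [^] j" using x(4) k c(1) by (simp add: int_pow_pow)
  ultimately obtain d and s t :: int where d: "d \<in> carrier G" "c = d [^] s" "y = d [^] t"
    using common_root[OF c(1) y c(2)] by blast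
  have "a \<in> range (\<lambda>n::int. d [^] n)" if "a \<in> A" for a
    using in_powers[OF that] d by (auto simp: int_pow_pow)
  then show ?thesis using that[of d] d by auto
qed

end

section \<open>Products of sets in unique product groups\<close>

context group
begin

lemma set_mult_iff: "g \<in> X <#> Y \<longleftrightarrow> (\<exists>a\<in>X. \<exists>b\<in>Y. g = a \<otimes> b)"
  by (auto simp: set_mult_def)

lemma finite_set_mult: "\<lbrakk>finite X; finite Y\<rbrakk> \<Longrightarrow> finite (X <#> Y)"
  by (simp add: set_mult_def)

lemma card_l_mult: "\<lbrakk>g \<in> carrier G; S \<subseteq> carrier G\<rbrakk> \<Longrightarrow> card ((\<otimes>) g ` S) = card S"
  by (intro card_image inj_on_subset[OF inj_on_cmult])

lemma l_mult_set_mult: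
  assumes "g \<in> carrier G" "X \<subseteq> carrier G" "Y \<subseteq> carrier G"
  shows "((\<otimes>) g ` X) <#> Y = (\<otimes>) g ` (X <#> Y)"
proof -
  have "g \<otimes> a \<otimes> b = g \<otimes> (a \<otimes> b)" if "a \<in> X" "b \<in> Y" for a b
    using assms that by (intro m_assoc) auto
  then show ?thesis by (force simp: set_mult_iff)
qed

lemma subgroup_powers:
  assumes "d \<in> carrier G"
  shows "subgroup (range (\<lambda>n::int. d [^] n)) G"
proof (rule subgroupI)
  show "inv a \<in> range (\<lambda>n::int. d [^] n)" if "a \<in> range (\<lambda>n::int. d [^] n)" for a
    using that assms by (auto simp: int_pow_neg[symmetric])
  show "a \<otimes> b \<in> range (\<lambda>n::int. d [^] n)"
    if "a \<in> range (\<lambda>n::int. d [^] n)" "b \<in> range (\<lambda>n::int. d [^] n)" for a b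
    using that assms by (auto simp: int_pow_mult[symmetric])
qed (use assms in auto)

lemma cyclic_subgroup_iff:
  "cyclic_subgroup H G \<longleftrightarrow> (\<exists>d\<in>carrier G. H = range (\<lambda>n::int. d [^] n))"
proof -
  have gen: "cyclic_group (G\<lparr>carrier := H\<rparr>) \<longleftrightarrow> (\<exists>d\<in>H. H = range (\<lambda>n::int. d [^] n))"
    if H: "subgroup H G"
  proof -
    interpret H: group "G\<lparr>carrier := H\<rparr>" by (rule subgroup.subgroup_is_group[OF H group_axioms])
    have "d [^]\<^bsub>G\<lparr>carrier := H\<rparr>\<^esub> n = d [^] n" if "d \<in> H" for d and n :: int
      using int_pow_consistent[OF H that] by simp
    then show ?thesis by (simp add: H.cyclic_group cong: bex_cong)
  qed
  show ?thesis
  proof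
    assume "cyclic_subgroup H G"
    then have "subgroup H G" "cyclic_group (G\<lparr>carrier := H\<rparr>)"
      by (simp_all add: cyclic_subgroup_def)
    then obtain d where "d \<in> H" "H = range (\<lambda>n::int. d [^] n)" "H \<subseteq> carrier G"
      using gen subgroup.subset by metis
    then show "\<exists>d\<in>carrier G. H = range (\<lambda>n::int. d [^] n)" by (metis subsetD)
  next
    assume "\<exists>d\<in>carrier G. H = range (\<lambda>n::int. d [^] n)"
    then obtain d where d: "d \<in> carrier G" "H = range (\<lambda>n::int. d [^] n)" by metis
    have "subgroup H G" using subgroup_powers[OF d(1)] d(2) by simp
    moreover have "d \<in> H" unfolding d(2) by (rule range_eqI[of _ _ 1]) (simp add: d(1))
    ultimately show "cyclic_subgroup H G"
      unfolding cyclic_subgroup_def using gen d(2) by metis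
  qed
qed

text \<open>As \<open>\<one> \<in> A\<close>, the product set contains \<open>B\<close>; it also
  contains the elements of \<open>x\<close>-translated \<open>B\<close> lying outside
  \<open>B\<close>, one for each progression end.\<close>

lemma chains_le_card_set_mult:
  assumes "A \<subseteq> carrier G" "finite A" "B \<subseteq> carrier G" "finite B"
    and "\<one> \<in> A" "x \<in> A"
  shows "card {b \<in> B. x \<otimes> b \<notin> B} + card B \<le> card (A <#> B)"
proof -
  have "card {b \<in> B. x \<otimes> b \<notin> B} + card B = card ((\<otimes>) x ` {b \<in> B. x \<otimes> b \<notin> B}) + card B"
    using assms card_l_mult[of x "{b \<in> B. x \<otimes> b \<notin> B}"] by (simp add: subset_iff)
  also have "\<dots> = card ((\<otimes>) x ` {b \<in> B. x \<otimes> b \<notin> B} \<union> B)"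
    using assms by (intro card_Un_disjoint[symmetric]) auto
  also have "\<dots> \<le> card (A <#> B)"
  proof (rule card_mono[OF finite_set_mult])
    have "\<one> \<otimes> b = b" if "b \<in> B" for b using that assms by auto
    then show "(\<otimes>) x ` {b \<in> B. x \<otimes> b \<notin> B} \<union> B \<subseteq> A <#> B"
      using assms(5,6) unfolding set_mult_def by fastforce
  qed (use assms in auto)
  finally show ?thesis .
qed

end

text \<open>If \<open>x\<close> has finite order, its powers form a finite set \<open>X\<close>. Any
  product of two elements of \<open>X\<close> is unchanged when \<open>x\<close> is moved from the
  right factor to the left one, so a unique representation forces \<open>x = \<one>\<close>.\<close>

lemma unique_product_group_imp_torsion_free:
  fixes G (structure)
  assumes "unique_product_group G"
  shows "torsion_free_group G"
proof -
  interpret unique_product_group G by (rule assms)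
  show ?thesis
  proof
    fix x and n :: nat
    assume x: "x \<in> carrier G" "x [^] n = \<one>" and n: "0 < n"
    define X where "X = range (\<lambda>k::nat. x [^] k)"
    have "x [^] k = x [^] (k mod n)" for k
    proof -
      have "x [^] k = x [^] (n * (k div n) + k mod n)" by simp
      also have "\<dots> = (x [^] n) [^] (k div n) \<otimes> x [^] (k mod n)"
        using x(1) by (simp only: nat_pow_mult[symmetric] nat_pow_pow nat_pow_closed)
      also have "\<dots> = x [^] (k mod n)" using x by simp
      finally show ?thesis .
    qed
    then have "X \<subseteq> (\<lambda>k. x [^] k) ` {..<n}" using n by (force simp: X_def)
    then have "finite X" by (meson finite_imageI finite_lessThan finite_subset)
    moreover have X: "X \<subseteq> carrier G" "X \<noteq> {}" using x by (auto simp: X_def)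
    ultimately have "\<exists>g \<in> X <#> X. \<exists>!p. p \<in> X \<times> X \<and> g = fst p \<otimes> snd p"
      by (intro unique_product)
    then obtain g p where p: "p \<in> X \<times> X" "g = fst p \<otimes> snd p"
      "\<And>q. q \<in> X \<times> X \<Longrightarrow> g = fst q \<otimes> snd q \<Longrightarrow> q = p"
      by blast
    obtain i j :: nat where ij: "p = (x [^] i, x [^] j)" using p(1) by (auto simp: X_def)
    \<comment> \<open>The power \<open>n - 1\<close> plays the role of the inverse of
      \<open>x\<close>, keeping all exponents natural numbers.\<close>
    have "x [^] Suc i \<otimes> x [^] (j + (n - 1)) = x [^] (i + j + n)"
      using x(1) n by (simp only: nat_pow_mult) (simp add: algebra_simps)
    also have "\<dots> = g" using p(2) ij x by (simp add: nat_pow_mult[symmetric])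
    finally have "g = x [^] Suc i \<otimes> x [^] (j + (n - 1))" ..
    moreover have "x [^] Suc i \<in> X" "x [^] (j + (n - 1)) \<in> X" unfolding X_def by (rule rangeI)+
    ultimately have "(x [^] Suc i, x [^] (j + (n - 1))) = p"
      by (intro p(3)) (simp_all only: mem_Times_iff fst_conv snd_conv)
    then have "x [^] i \<otimes> x = x [^] i \<otimes> \<one>" using ij x by simp
    then show "x = \<one>" using x(1) by simp
  qed
qed

sublocale unique_product_group \<subseteq> torsion_free_group
  by (rule unique_product_group_imp_torsion_free) unfold_locales

section \<open>Lower bounds for product sets\<close>

context unique_product_group
begin

text \<open>Deleting the left factor of a uniquely represented product loses at least that
  product.\<close>

lemma exists_removable:
  assumes "finite X" "X \<noteq> {}" "X \<subseteq> carrier G" "finite Y" "Y \<noteq> {}" "Y \<subseteq> carrier G"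
  obtains a where "a \<in> X" "card ((X - {a}) <#> Y) < card (X <#> Y)"
proof -
  obtain g p where p: "p \<in> X \<times> Y" "g = fst p \<otimes> snd p"
    "\<And>q. q \<in> X \<times> Y \<Longrightarrow> g = fst q \<otimes> snd q \<Longrightarrow> q = p"
    using unique_product[OF assms] by blast
  have "g \<notin> (X - {fst p}) <#> Y" using p(3) by (fastforce simp: set_mult_iff)
  moreover have "g \<in> X <#> Y" unfolding set_mult_iff using p(1,2) by (metis mem_Times_iff)
  moreover have "(X - {fst p}) <#> Y \<subseteq> X <#> Y" by (intro mono_set_mult) auto
  ultimately have "card ((X - {fst p}) <#> Y) < card (X <#> Y)"
    using assms by (intro psubset_card_mono finite_set_mult) auto
  then show ?thesis using that[of "fst p"] p(1) by auto
qed

lemma card_set_mult_ge: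
  assumes "finite X" "X \<noteq> {}" "X \<subseteq> carrier G" "finite Y" "Y \<noteq> {}" "Y \<subseteq> carrier G"
  shows "card X + card Y \<le> card (X <#> Y) + 1"
  using assms(1-3)
proof (induction X rule: finite_psubset_induct)
  case (psubset X)
  obtain a where a: "a \<in> X" "card ((X - {a}) <#> Y) < card (X <#> Y)"
    using exists_removable[OF psubset(1,3,4) assms(4-6)] by blast
  show ?case
  proof (cases "X = {a}")
    case True
    then have "X <#> Y = (\<otimes>) a ` Y" by (auto simp: set_mult_def)
    then show ?thesis using True card_l_mult[of a Y] a(1) psubset.prems assms(6) by auto
  next
    case False
    then have "card (X - {a}) + card Y \<le> card ((X - {a}) <#> Y) + 1"
      using psubset.prems a(1) by (intro psubset.IH) auto
    moreover have "card X = Suc (card (X - {a}))" using card_Suc_Diff1[OF psubset(1) a(1)] by simp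
    ultimately show ?thesis using a(2) by linarith
  qed
qed

text \<open>Each removal lowers the size of \<open>A\<close> by one and that of the product set by
  at least one; it is repeated until the next removal would establish \<open>P\<close>. Sums replace
  differences to avoid truncated subtraction.\<close>

lemma reduce_left_factor:
  assumes "finite A" "A \<subseteq> carrier G" "finite B" "B \<noteq> {}" "B \<subseteq> carrier G"
    and "P {}" "\<not> P A"
  obtains A' a where "A' \<subseteq> A" "\<not> P A'" "a \<in> A'" "P (A' - {a})"
    "card (A' <#> B) + card A \<le> card (A <#> B) + card A'"
proof -
  have "\<exists>A' a. A' \<subseteq> A \<and> \<not> P A' \<and> a \<in> A' \<and> P (A' - {a})
      \<and> card (A' <#> B) + card A \<le> card (A <#> B) + card A'"
    using assms(1,2,7)
  proof (induction A rule: finite_psubset_induct)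
    case (psubset A)
    then have "A \<noteq> {}" using \<open>P {}\<close> by auto
    then obtain a where a: "a \<in> A" "card ((A - {a}) <#> B) < card (A <#> B)"
      using exists_removable[of A B] psubset assms by blast
    show ?case
    proof (cases "P (A - {a})")
      case True
      then show ?thesis using a(1) psubset.prems by blast
    next
      case False
      then obtain A' a' where A': "A' \<subseteq> A - {a}" "\<not> P A'" "a' \<in> A'" "P (A' - {a'})"
        "card (A' <#> B) + card (A - {a}) \<le> card ((A - {a}) <#> B) + card A'"
        using psubset.IH[of "A - {a}"] a(1) psubset.prems by auto
      moreover have "card A = Suc (card (A - {a}))" using card_Suc_Diff1[OF psubset(1) a(1)] by simp
      ultimately have "card (A' <#> B) + card A \<le> card (A <#> B) + card A'"
        using a(2) by linarith
      then show ?thesis using A' by blast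
    qed
  qed
  then show ?thesis using that by blast
qed

text \<open>Multiplication by \<open>A \<subseteq> C\<close> preserves right cosets of
  \<open>C\<close>. The parts of \<open>B\<close> inside and outside the coset of \<open>b\<close>
  thus have disjoint products with \<open>A\<close>, and the general bound applies to each, losing 1
  twice.\<close>

lemma card_set_mult_two_cosets:
  assumes A: "finite A" "A \<noteq> {}" "A \<subseteq> C" and C: "subgroup C G"
    and B: "finite B" "B \<subseteq> carrier G"
    and b: "b \<in> B" "c \<in> B" "c \<otimes> inv b \<notin> C"
  shows "2 * card A + card B \<le> card (A <#> B) + 2"
proof -
  define B1 B2 where "B1 = {h \<in> B. h \<otimes> inv b \<in> C}" and "B2 = {h \<in> B. h \<otimes> inv b \<notin> C}"
  have Cc: "C \<subseteq> carrier G" by (rule subgroup.subset[OF C])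
  have Ac: "A \<subseteq> carrier G" using A Cc by blast
  have bc: "b \<in> carrier G" using b B by blast
  have "b \<in> B1" using b(1) bc subgroup.one_closed[OF C] by (simp add: B1_def)
  then have B1: "finite B1" "B1 \<noteq> {}" "B1 \<subseteq> carrier G" using B by (auto simp: B1_def)
  have B2: "finite B2" "B2 \<noteq> {}" "B2 \<subseteq> carrier G" using B b by (auto simp: B2_def)
  have coset: "a \<otimes> h \<otimes> inv b \<in> C \<longleftrightarrow> h \<otimes> inv b \<in> C" if "a \<in> A" "h \<in> B" for a h
  proof -
    have aC: "a \<in> C" and ac: "a \<in> carrier G" and hc: "h \<in> carrier G" using that A Cc B by blast+
    have "a \<otimes> h \<otimes> inv b = a \<otimes> (h \<otimes> inv b)" using ac hc bc by (simp add: m_assoc)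
    moreover have "h \<otimes> inv b = inv a \<otimes> (a \<otimes> (h \<otimes> inv b))" using ac hc bc by (simp flip: m_assoc)
    ultimately show ?thesis
      using aC subgroup.m_closed[OF C] subgroup.m_inv_closed[OF C] by metis
  qed
  have disj: "(A <#> B1) \<inter> (A <#> B2) = {}"
  proof -
    have "g \<otimes> inv b \<in> C" if "g \<in> A <#> B1" for g
      using that coset by (auto simp: set_mult_iff B1_def)
    moreover have "g \<otimes> inv b \<notin> C" if "g \<in> A <#> B2" for g
      using that coset by (auto simp: set_mult_iff B2_def)
    ultimately show ?thesis by blast
  qed
  have "A <#> B = (A <#> B1) \<union> (A <#> B2)" by (auto simp: set_mult_def B1_def B2_def)
  then have "card (A <#> B) = card (A <#> B1) + card (A <#> B2)"
    using disj A B1 B2 by (simp add: card_Un_disjoint finite_set_mult)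
  moreover have "card B = card B1 + card B2"
  proof -
    have "B = B1 \<union> B2" "B1 \<inter> B2 = {}" by (auto simp: B1_def B2_def)
    then show ?thesis using B1 B2 by (simp add: card_Un_disjoint)
  qed
  moreover have "card A + card B1 \<le> card (A <#> B1) + 1" "card A + card B2 \<le> card (A <#> B2) + 1"
    using card_set_mult_ge A Ac B1 B2 by blast+
  ultimately show ?thesis by linarith
qed

text \<open>Quotients \<open>h' \<otimes> inv h\<close> of elements of \<open>B\<close> lie in
  \<open>C\<close>, so a coincidence \<open>y \<otimes> h = a \<otimes> h'\<close> would put
  \<open>y\<close> into \<open>C\<close>. Hence the \<open>y\<close>-translate of \<open>B\<close>
  is disjoint from \<open>A <#> B\<close>.\<close>

lemma card_set_mult_one_coset:
  assumes A: "finite A" "A \<noteq> {}" "A \<subseteq> C" and C: "subgroup C G"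
    and B: "finite B" "B \<subseteq> carrier G"
    and b: "b \<in> B" "\<And>h. h \<in> B \<Longrightarrow> h \<otimes> inv b \<in> C"
    and y: "y \<in> carrier G" "y \<notin> C"
  shows "card A + 2 * card B \<le> card (insert y A <#> B) + 1"
proof -
  have Cc: "C \<subseteq> carrier G" by (rule subgroup.subset[OF C])
  have Ac: "A \<subseteq> carrier G" using A Cc by blast
  have bc: "b \<in> carrier G" using b B by blast
  have "y \<otimes> h \<noteq> a \<otimes> h'" if "a \<in> A" "h \<in> B" "h' \<in> B" for a h h'
  proof
    assume eq: "y \<otimes> h = a \<otimes> h'"
    have c: "a \<in> carrier G" "h \<in> carrier G" "h' \<in> carrier G" using that Ac B by blast+
    have "y = a \<otimes> h' \<otimes> inv h" using eq c y(1) by (metis inv_solve_right m_closed)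
    also have "\<dots> = a \<otimes> ((h' \<otimes> inv b) \<otimes> inv (h \<otimes> inv b))"
      using c bc inv_solve_right[of "h' \<otimes> inv h"] 
      by (simp add: inv_mult_group m_assoc) (simp flip: m_assoc)
    also have "\<dots> \<in> C"
    proof (rule subgroup.m_closed[OF C _ subgroup.m_closed[OF C _ subgroup.m_inv_closed[OF C]]])
      show "a \<in> C" using that(1) A(3) by blast
      show "h' \<otimes> inv b \<in> C" "h \<otimes> inv b \<in> C" using that(2,3) b(2) by auto
    qed
    finally show False using y(2) by blast
  qed
  then have disj: "(\<otimes>) y ` B \<inter> (A <#> B) = {}" by (auto simp: set_mult_iff)
  have "insert y A <#> B = (\<otimes>) y ` B \<union> (A <#> B)" by (auto simp: set_mult_def)
  then have "card (insert y A <#> B) = card B + card (A <#> B)"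
    using disj A B card_l_mult[OF y(1) B(2)] by (simp add: card_Un_disjoint finite_set_mult)
  moreover have "B \<noteq> {}" using b(1) by blast
  ultimately show ?thesis using card_set_mult_ge[OF A(1,2) Ac B(1) _ B(2)] by simp
qed

lemma insert_in_powers_if_card_le:
  assumes g: "g \<in> carrier G" and A: "A \<subseteq> range (\<lambda>n::int. g [^] n)" "finite A" "\<one> \<in> A"
    and x: "x \<in> A" "x \<noteq> \<one>"
    and y: "y \<in> carrier G" "y \<notin> range (\<lambda>n::int. g [^] n)"
    and B: "finite B" "B \<subseteq> carrier G"
    and k: "1 \<le> k" "4 * (2 * k + 3) ^ 3 < card B"
    and le: "card (insert y A <#> B) \<le> Suc (card A) + card B + k"
  obtains d where "d \<in> carrier G" "insert y A \<subseteq> range (\<lambda>n::int. d [^] n)"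
proof -
  \<comment> \<open>The two-coset bound and \<open>le\<close> give
    \<open>card A \<le> k + 3\<close>; inserting this into \<open>le\<close> bounds the product set
    by \<open>card B + m\<close>.\<close>
  define m where "m = 2 * k + 4"
  have C: "subgroup (range (\<lambda>n::int. g [^] n)) G" by (rule subgroup_powers[OF g])
  have Ac: "A \<subseteq> carrier G" using A g by auto
  have "0 < card B" using k by linarith
  then have "B \<noteq> {}" by auto
  then obtain b where b: "b \<in> B" by blast
  \<comment> \<open>This uses \<open>1 \<le> k\<close>: at \<open>k = 0\<close> the sides would be
    128 and 108.\<close>
  have "2 * (2 * k + 4) ^ 3 \<le> 4 * (2 * k + 3) ^ 3"
  proof -
    obtain l where "k = Suc l" using k(1) by (cases k) auto
    then show ?thesis by (simp add: power3_eq_cube algebra_simps)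
  qed
  then have m: "2 * m ^ 3 < card B" using k(2) by (simp add: m_def)
  have "k + 2 < card B"
  proof -
    have "2 * k + 3 \<le> (2 * k + 3) ^ 3" by (rule self_le_power) auto
    then show ?thesis using k(2) by linarith
  qed
  have "\<not> (\<forall>h\<in>B. h \<otimes> inv b \<in> range (\<lambda>n::int. g [^] n))"
  proof
    assume "\<forall>h\<in>B. h \<otimes> inv b \<in> range (\<lambda>n::int. g [^] n)"
    then have "card A + 2 * card B \<le> card (insert y A <#> B) + 1"
      using A(3) by (intro card_set_mult_one_coset[OF A(2) _ A(1) C B b _ y]) auto
    then show False using le \<open>k + 2 < card B\<close> by linarith
  qed
  then obtain c where c: "c \<in> B" "c \<otimes> inv b \<notin> range (\<lambda>n::int. g [^] n)" by blast
  have "2 * card A + card B \<le> card (A <#> B) + 2"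
    using A(3) by (intro card_set_mult_two_cosets[OF A(2) _ A(1) C B b c]) auto
  moreover have "card (A <#> B) \<le> card (insert y A <#> B)"
    using A(2) B(1) by (intro card_mono finite_set_mult mono_set_mult) auto
  ultimately have "card (insert y A <#> B) \<le> card B + m"
    using le unfolding m_def by linarith
  then have few: "card {b \<in> B. h \<otimes> b \<notin> B} \<le> m" if "h \<in> insert y A" for h
    using chains_le_card_set_mult[of "insert y A" B h] that Ac A(2,3) y(1) B by auto
  have y1: "y \<noteq> \<one>" using y(2) A by auto
  \<comment> \<open>Every nontrivial \<open>h \<in> A\<close> is paired with \<open>y\<close>.
    Commutation is used for all of \<open>A\<close>, the power relation only for
    \<open>x\<close>.\<close>
  have comm: "h \<otimes> y = y \<otimes> h \<and> (\<exists>(i::int) (j::int). i \<noteq> 0 \<and> j \<noteq> 0 \<and> h [^] i = y [^] j)"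
    if "h \<in> A" "h \<noteq> \<one>" for h
    using few_chains_imp_commensurable[of h y B m] that Ac y(1) y1 B few m by blast
  then obtain i j :: int where "i \<noteq> 0" "x [^] i = y [^] j" using x by blast
  moreover have "h \<otimes> y = y \<otimes> h" if "h \<in> A" for h
    using comm[OF that] y(1) by (cases "h = \<one>") auto
  ultimately show ?thesis using powers_of_common_root[OF g A(1) y(1) _ x] that by blast
qed

section \<open>Cosets of cyclic subgroups and the final contradiction\<close>

lemma cyclic_coset_iff:
  "(\<exists>H g. cyclic_subgroup H G \<and> g \<in> carrier G \<and> A \<subseteq> g <# H) \<longleftrightarrow>
    (\<exists>d\<in>carrier G. \<exists>g\<in>carrier G. A \<subseteq> (\<otimes>) g ` range (\<lambda>n::int. d [^] n))"
proof -
  have "g <# H = (\<otimes>) g ` H" for g H by (auto simp: l_coset_def)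
  then show ?thesis unfolding cyclic_subgroup_iff by metis
qed

lemma pair_in_cyclic_coset:
  assumes "u \<in> carrier G" "v \<in> carrier G"
  shows "\<exists>d\<in>carrier G. \<exists>g\<in>carrier G. {u, v} \<subseteq> (\<otimes>) g ` range (\<lambda>n::int. d [^] n)"
proof -
  define d where "d = inv u \<otimes> v"
  have d: "d \<in> carrier G" using assms by (simp add: d_def)
  have "u = u \<otimes> d [^] (0::int)" using assms(1) by simp
  moreover have "v = u \<otimes> d [^] (1::int)"
    using assms unfolding int_pow_1[OF d] by (simp add: d_def flip: m_assoc)
  ultimately have "{u, v} \<subseteq> (\<otimes>) u ` range (\<lambda>n::int. d [^] n)" by blast
  then show ?thesis using d assms(1) by blast
qed

end

theorem lemma12:
  fixes G :: "('a, 'b) monoid_scheme" (structure)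
    and A B :: "'a set" and k :: nat
  assumes "unique_product_group G"
    and "A \<subseteq> carrier G" and "finite A"
    and "B \<subseteq> carrier G" and "finite B"
    and "k \<ge> 1"
    and "\<not> (\<exists>H g. cyclic_subgroup H G \<and> g \<in> carrier G \<and> A \<subseteq> g <# H)"
    and "card B > 4 * (2 * k + 3) ^ 3"
  shows "card (A <#> B) > card A + card B + k"
proof (rule ccontr)
  interpret unique_product_group G by (rule assms(1))
  assume "\<not> ?thesis"
  then have le: "card (A <#> B) \<le> card A + card B + k" by simp
  define P where "P S \<longleftrightarrow> (\<exists>d\<in>carrier G. \<exists>g\<in>carrier G. S \<subseteq> (\<otimes>) g ` range (\<lambda>n::int. d [^] n))" for S
  have P_subset: "P S" if "P T" "S \<subseteq> T" for S T using that unfolding P_def by (meson order_trans)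
  have "\<not> P A" using assms(7) unfolding P_def cyclic_coset_iff .
  have P_pair: "P {u, v}" if "u \<in> carrier G" "v \<in> carrier G" for u v
    unfolding P_def using that by (rule pair_in_cyclic_coset)
  have "P {}" using P_subset[OF P_pair[of \<one> \<one>]] by simp
  have "B \<noteq> {}" using assms(8) by auto
  obtain A' a where A': "A' \<subseteq> A" "\<not> P A'" "a \<in> A'" "P (A' - {a})"
    "card (A' <#> B) + card A \<le> card (A <#> B) + card A'"
    using reduce_left_factor[of A B P] assms(2-5) \<open>B \<noteq> {}\<close> \<open>P {}\<close> \<open>\<not> P A\<close> by blast
  define A1 where "A1 = A' - {a}"
  have ac: "a \<in> carrier G" using A'(1,3) assms(2) by blast
  have A1: "A1 \<subseteq> carrier G" "finite A1" "A' = insert a A1" "a \<notin> A1"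
    using A'(1,3) assms(2) finite_subset[OF _ assms(3)] by (auto simp: A1_def)
  \<comment> \<open>Any one or two elements lie in a coset of a cyclic subgroup, so
    \<open>A'\<close> has at least two elements besides \<open>a\<close>: one becomes the base
    point, the other gives a nontrivial element after translation.\<close>
  obtain u where u: "u \<in> A1"
    using A'(2) P_subset[OF P_pair[OF ac ac], of A'] A1(3) by blast
  obtain v where v: "v \<in> A1" "v \<noteq> u"
    using A'(2) P_subset[OF P_pair[OF ac, of u], of A'] A1(1,3) u by blast
  have uc: "u \<in> carrier G" using u A1 by blast
  have iu: "inv u \<in> carrier G" using uc by simp
  obtain g h where g: "g \<in> carrier G" and h: "h \<in> carrier G"
    and sub: "A1 \<subseteq> (\<otimes>) h ` range (\<lambda>n::int. g [^] n)"
    using A'(4) unfolding P_def A1_def by blast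
  define A2 where "A2 = (\<otimes>) (inv u) ` A1"
  define y where "y = inv u \<otimes> a"
  have y: "y \<in> carrier G" using ac uc by (simp add: y_def)
  have A2: "A2 \<subseteq> range (\<lambda>n::int. g [^] n)"
  proof
    fix s assume "s \<in> A2"
    then obtain w where w: "w \<in> A1" "s = inv u \<otimes> w" by (auto simp: A2_def)
    obtain i j :: int where "u = h \<otimes> g [^] i" "w = h \<otimes> g [^] j" using u w(1) sub by blast
    \<comment> \<open>The base point \<open>h\<close> of the coset cancels, leaving only powers of
      \<open>g\<close>.\<close>
    then have "s = inv (g [^] i) \<otimes> g [^] j"
      using w(2) g h by (simp add: inv_mult_group m_assoc) (simp flip: m_assoc)
    then have "s = g [^] (- i + j)" using g by (simp only: int_pow_mult int_pow_neg)
    then show "s \<in> range (\<lambda>n::int. g [^] n)" by blast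
  qed
  have A2': "\<one> \<in> A2" "inv u \<otimes> v \<in> A2" "inv u \<otimes> v \<noteq> \<one>"
  proof -
    show "\<one> \<in> A2" using u uc by (auto simp: A2_def intro!: image_eqI[of _ _ u])
    show "inv u \<otimes> v \<in> A2" using v(1) by (simp add: A2_def)
    show "inv u \<otimes> v \<noteq> \<one>"
      using v A1(1) uc by (metis inv_solve_left one_closed r_one subsetD)
  qed
  have finA2: "finite A2" using A1(2) by (simp add: A2_def)
  have translate: "insert y A2 = (\<otimes>) (inv u) ` A'" by (simp add: A1(3) A2_def y_def)
  have A'_eq: "A' = (\<otimes>) u ` insert y A2"
  proof -
    have "u \<otimes> (inv u \<otimes> s) = s" if "s \<in> A'" for s
      using that A1(1,3) ac uc by (auto simp flip: m_assoc)
    then show ?thesis unfolding translate image_image by simp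
  qed
  \<comment> \<open>Translating back by \<open>u\<close> would put \<open>A'\<close> into a coset of
    a cyclic subgroup.\<close>
  have not_powers: "\<not> insert y A2 \<subseteq> range (\<lambda>n::int. d [^] n)" if "d \<in> carrier G" for d
    using A'(2) that uc unfolding P_def A'_eq by (meson image_mono)
  have yC: "y \<notin> range (\<lambda>n::int. g [^] n)" using not_powers[OF g] A2 by blast
  have A'c: "A' \<subseteq> carrier G" using A1(1,3) ac by blast
  have "card (insert y A2 <#> B) = card (A' <#> B)"
    unfolding translate l_mult_set_mult[OF iu A'c assms(4)]
    by (rule card_l_mult[OF iu set_mult_closed[OF A'c assms(4)]])
  moreover have "card A2 = card A1" unfolding A2_def by (rule card_l_mult[OF iu A1(1)])
  moreover have "card A' = Suc (card A1)" using A1 by simp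
  ultimately have "card (insert y A2 <#> B) \<le> Suc (card A2) + card B + k"
    using A'(5) le by linarith
  from insert_in_powers_if_card_le[OF g A2 finA2 A2' y yC assms(5,4,6,8) this]
  show False using not_powers by blast
qed

end
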